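(* Let $a,c$ be real numbers with $0<a<1<c$ and $c\notin\mathbb N$. Put $$x_1=\max\Big(\frac{a+\langle c\rangle-1}a,0\Big),\qquad x_2=\min\Big(\frac{\langle c\rangle}a,1\Big),$$ and $\alpha=\big\langle\frac{\lfloor c\rfloor}a\big\rangle$ if $x_2\ne1$, $\alpha=\big\langle\frac ca\big\rangle$ if $x_2=1$. Let $\mathcal{S}$ be the maximal invariant set of $\mathcal{M}=\mathcal{M}_{\alpha,x_1,x_2}$ and suppose $\mathcal{S}\ne\emptyset$. Then $Y(\alpha)\in\mathbb Q$ if and only if $a\in\mathbb Q$.
   Context: $\lfloor x\rfloor$ is the greatest integer $\le x$ and $\langle x\rangle=x-\lfloor x\rfloor$. For $0\le\alpha<1$ and $0\le x_1<x_2\le 1$ put $U=[0,x_1)$, $\mathbf H=[x_1,x_2)$, $V=[x_2,1)$. The map $\mathcal{M}=\mathcal{M}_{\alpha,x_1,x_2}:[0,1)\to[0,1)$ is $\mathcal{M}(t)=\langle t+\alpha+x_2-x_1\rangle$ for $t\in U$, $\mathcal{M}(t)=t$ for $t\in\mathbf H$, $\mathcal{M}(t)=\langle t+\alpha\rangle$ for $t\in V$. The maximal invariant set $\mathcal{S}$ of $\mathcal{M}$ is the largest set $\mathcal{S}\subset[0,1)\setminus\mathbf H$ with $\mathcal{M}(\mathcal{S})=\mathcal{S}$; it is a finite union of left-closed right-open intervals. If $\mathcal{S}\ne\emptyset$, the map $Y:[0,1)\to[0,1)$ is $Y(t)=\big\langle |\mathcal{S}\cap[0,t)|/|\mathcal{S}|\big\rangle$,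 where $|\cdot|$ is Lebesgue measure. *)

theory Defs
  imports "HOL-Analysis.Analysis"
begin

definition hole :: "real \<Rightarrow> real \<Rightarrow> real set" where
  "hole x1 x2 = {x1..<x2}"

text \<open>Only the values on \<open>[0,1)\<close> are meaningful; there, the last branch is the
  interval \<open>V = [x\<^sub>2,1)\<close>.\<close>

definition hole_map :: "real \<Rightarrow> real \<Rightarrow> real \<Rightarrow> real \<Rightarrow> real" where
  "hole_map \<alpha> x1 x2 t =
     (if t \<in> {0..<x1} then frac (t + \<alpha> + x2 - x1)
      else if t \<in> hole x1 x2 then t
      else frac (t + \<alpha>))"

definition invariant_off_hole :: "real \<Rightarrow> real \<Rightarrow> real \<Rightarrow> real set \<Rightarrow> bool" where
  "invariant_off_hole \<alpha> x1 x2 S \<longleftrightarrow>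
     S \<subseteq> {0..<1} - hole x1 x2 \<and> hole_map \<alpha> x1 x2 ` S = S"

text \<open>\<open>GREATEST\<close> refers to the inclusion order on sets.\<close>

definition max_invariant_set :: "real \<Rightarrow> real \<Rightarrow> real \<Rightarrow> real set" where
  "max_invariant_set \<alpha> x1 x2 = (GREATEST S. invariant_off_hole \<alpha> x1 x2 S)"

lemma max_invariant_set_eq_Union:
  "max_invariant_set \<alpha> x1 x2 = \<Union>{S. invariant_off_hole \<alpha> x1 x2 S}"
  unfolding max_invariant_set_def
proof (rule Greatest_equality)
  show "invariant_off_hole \<alpha> x1 x2 (\<Union>{S. invariant_off_hole \<alpha> x1 x2 S})"
    unfolding invariant_off_hole_def by blast
qed blast

lemma invariant_off_hole_max_invariant_set:
  "invariant_off_hole \<alpha> x1 x2 (max_invariant_set \<alpha> x1 x2)"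
  unfolding max_invariant_set_eq_Union unfolding invariant_off_hole_def by blast

lemma max_invariant_set_greatest:
  "invariant_off_hole \<alpha> x1 x2 S \<Longrightarrow> S \<subseteq> max_invariant_set \<alpha> x1 x2"
  unfolding max_invariant_set_eq_Union by blast

text \<open>The map \<open>Y\<close> attached to \<open>S\<close>; meaningful when \<open>S\<close> has positive measure
  and \<open>t \<in> [0,1)\<close>.\<close>

definition squeeze_map :: "real set \<Rightarrow> real \<Rightarrow> real" where
  "squeeze_map S t = frac (measure lebesgue (S \<inter> {0..<t}) / measure lebesgue S)"

end

(*
  Lift the map to the real line, collapsing the hole to a point: this gives a monotone map F of
  degree one.  On the maximal invariant set S every step translates by j/a modulo 1 with a positive
  integer j, and t \<mapsto> |S \<inter> [0,t)| / |S| conjugates the action on S to the rotation by Y(\<alpha>).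
  If a is rational, orbits in S are finite, so the rotation has finite order.
  If a is irrational, S has no periodic points.  Following the gaps of S under F, the gap
  containing 0 is a point; its image has length x2 - x1 (the gap in the range of M), and since the
  total length is bounded the gap must be absorbed by the hole after N steps.  So S has exactly N gaps
  of this length, which cannot fill the circle, since x2 - x1 = 1/a - 1 is irrational; hence |S| > 0.
  If Y(\<alpha>) = p/q, the q-th iterate of F would move the points of S by bounded total amounts in one
  direction, with finitely many possible step sizes, which forces a periodic point.
*)
theory Submission
  imports Defs
begin

section \<open>Monotone lift of the map to the real line\<close>

locale holed_rotation =
  fixes \<alpha> x1 x2 :: real
  assumes x1_nonneg: "0 \<le> x1" and x1_less_x2: "x1 < x2" and x2_le_1: "x2 \<le> 1"
    and alpha_nonneg: "0 \<le> \<alpha>" and alpha_less_1: "\<alpha> < 1"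
begin

lemmas params = x1_nonneg x1_less_x2 x2_le_1 alpha_nonneg alpha_less_1

text \<open>The constant on the hole is the common value of the two outer formulas, the first taken
  at \<open>x1\<close> and the second at \<open>x2\<close>. So the hole collapses to a point, and
  the only discontinuities are upward jumps by \<open>x2 - x1\<close> at the integers.\<close>

definition lift_map :: "real \<Rightarrow> real" where
  "lift_map x = (if frac x < x1 then x + \<alpha> + (x2 - x1)
     else if frac x < x2 then of_int \<lfloor>x\<rfloor> + \<alpha> + x2
     else x + \<alpha>)"

definition off_hole :: "real set" where
  "off_hole = {x. frac x < x1 \<or> x2 \<le> frac x}"

lemma lift_map_add_int [simp]: "lift_map (x + of_int m) = lift_map x + of_int m"
  by (simp add: lift_map_def frac_def)

lemma off_hole_add_int [simp]: "x + of_int m \<in> off_hole \<longleftrightarrow> x \<in> off_hole"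
  by (simp add: off_hole_def frac_def)

lemma hole_map_eq_frac_lift_map:
  assumes "t \<in> {0..<1} - hole x1 x2"
  shows "hole_map \<alpha> x1 x2 t = frac (lift_map t)"
proof -
  have "frac t = t" using assms by (simp add: frac_eq)
  then show ?thesis
    using assms params by (auto simp: hole_map_def lift_map_def hole_def algebra_simps)
qed

lemma frac_lift_map_frac: "frac (lift_map (frac x)) = frac (lift_map x)"
proof -
  have "lift_map x = lift_map (frac x) + of_int \<lfloor>x\<rfloor>"
    using lift_map_add_int[of "frac x" "\<lfloor>x\<rfloor>"] by (simp add: frac_def)
  then show ?thesis by (simp add: frac_def)
qed

text \<open>Case split for monotonicity: within one period the branches are compared directly;
  across periods \<open>of_int \<lfloor>x\<rfloor> + 1 + \<alpha>\<close> separates the two values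
  of the lift.\<close>

lemma floor_cases:
  fixes x y :: real
  assumes "x \<le> y"
  obtains "\<lfloor>x\<rfloor> = \<lfloor>y\<rfloor>" | "real_of_int \<lfloor>x\<rfloor> + 1 \<le> real_of_int \<lfloor>y\<rfloor>"
  using floor_mono[OF assms] by linarith

lemma lift_map_mono: "x \<le> y \<Longrightarrow> lift_map x \<le> lift_map y"
  using params frac_lt_1[of x] frac_ge_0[of y] frac_lt_1[of y]
  by (rule_tac floor_cases[of x y]) (auto simp: lift_map_def frac_def)

text \<open>Flat pieces lie in translates of \<open>{x1..x2}\<close>, and a point off the hole can
  meet such a piece only in its right end.\<close>

lemma lift_map_strict_mono:
  assumes "x < y" "x \<in> off_hole"
  shows "lift_map x < lift_map y"
  using assms params frac_lt_1[of x] frac_ge_0[of y] frac_lt_1[of y]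
  by (rule_tac floor_cases[of x y]) (auto simp: lift_map_def frac_def off_hole_def)

lemma inj_on_lift_map: "inj_on lift_map off_hole"
  by (rule linorder_inj_onI') (metis lift_map_strict_mono less_irrefl)

text \<open>Serves to pass to limits of \<open>S\<close> from the right. In the proof,
  \<open>e\<close> is the distance to the end of the current branch, on which the slope is 0 or
  1.\<close>

lemma lift_map_right_cont:
  obtains e where "0 < e" "\<And>y. x \<le> y \<Longrightarrow> y < x + e \<Longrightarrow> lift_map y \<le> lift_map x + (y - x)"
proof
  define e where "e = (if frac x < x1 then x1 - frac x else if frac x < x2 then x2 - frac x
    else 1 - frac x)"
  show "0 < e" using frac_lt_1[of x] by (auto simp: e_def)
  fix y assume y: "x \<le> y" "y < x + e"
  have "\<lfloor>y\<rfloor> = \<lfloor>x\<rfloor>"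
    using y params frac_lt_1[of x] by (intro floor_unique) (auto simp: e_def frac_def split: if_splits; linarith)+
  then show "lift_map y \<le> lift_map x + (y - x)"
    using y by (auto simp: lift_map_def e_def frac_def split: if_splits)
qed

lemma lift_map_ge: "x \<le> lift_map x"
  using params by (auto simp: lift_map_def frac_def)

lemma lift_map_le: "lift_map x \<le> x + 2"
  using params by (auto simp: lift_map_def frac_def)

lemma lift_map_0: "lift_map 0 = \<alpha> + (x2 - x1)"
  using params by (auto simp: lift_map_def)

text \<open>Together with \<open>lift_map_0\<close>, this identifies
  \<open>{\<alpha>..<\<alpha> + (x2 - x1)}\<close> as the interval that points off the hole never
  reach, because of the jump at 0.\<close>

lemma lift_map_neg:
  assumes "x < 0" "x \<in> off_hole"
  shows "lift_map x < \<alpha>"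
proof -
  have "\<lfloor>x\<rfloor> \<le> -1" using assms(1) by linarith
  then have "real_of_int \<lfloor>x\<rfloor> + 1 \<le> 0" by linarith
  then show ?thesis
    using assms params frac_lt_1[of x] by (auto simp: lift_map_def frac_def off_hole_def)
qed

text \<open>Off the hole the lift is injective and a translation on each of its two
  branches.\<close>

lemma measure_lift_map_image:
  assumes "A \<in> lmeasurable" "A \<in> sets borel" "A \<subseteq> off_hole"
  shows "measure lebesgue (lift_map ` A) = measure lebesgue A"
proof -
  let ?U = "A \<inter> {x. frac x < x1}" and ?V = "A \<inter> {x. x2 \<le> frac x}"
  have A: "A = ?U \<union> ?V" "?U \<inter> ?V = {}"
    using assms x1_less_x2 by (auto simp: off_hole_def)
  have "{x. frac x < x1} \<in> sets borel" "{x. x2 \<le> frac x} \<in> sets borel"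
    unfolding frac_def by measurable
  then have m: "?U \<in> lmeasurable" "?V \<in> lmeasurable"
    using assms by (auto intro!: bounded_set_imp_lmeasurable fmeasurable_Int_fmeasurable)
  have U: "lift_map ` ?U = (+) (\<alpha> + (x2 - x1)) ` ?U"
    by (intro image_cong) (auto simp: lift_map_def)
  have V: "lift_map ` ?V = (+) \<alpha> ` ?V"
    using x1_less_x2 by (intro image_cong) (auto simp: lift_map_def)
  have "lift_map ` ?U \<inter> lift_map ` ?V = {}"
    using A(2) assms(3) inj_on_image_Int[OF inj_on_lift_map, of ?U ?V] by auto
  moreover have "lift_map ` ?U \<in> lmeasurable" "lift_map ` ?V \<in> lmeasurable"
    unfolding U V using m by (auto intro: measurable_translation)
  ultimately have "measure lebesgue (lift_map ` ?U \<union> lift_map ` ?V) =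
      measure lebesgue (lift_map ` ?U) + measure lebesgue (lift_map ` ?V)"
    by (intro measure_Un3[THEN trans]) auto
  also have "\<dots> = measure lebesgue ?U + measure lebesgue ?V"
    unfolding U V by (simp add: measure_translation)
  also have "\<dots> = measure lebesgue (?U \<union> ?V)"
    using m A(2) by (simp add: measure_Un3)
  finally show ?thesis using A(1) by (metis image_Un)
qed

end

section \<open>Periodic extension of the invariant set and the right ends of its gaps\<close>

locale holed_rotation_nonempty = holed_rotation +
  assumes S_nonempty: "max_invariant_set \<alpha> x1 x2 \<noteq> {}"
begin

definition S :: "real set" where
  "S = max_invariant_set \<alpha> x1 x2"

definition SL :: "real set" where
  "SL = {x. frac x \<in> S}"

text \<open>Labels gaps by their right ends. As an infimum it makes sense before \<open>SL\<close>
  is known to contain its limits from the right; its fixed points are \<open>SL\<close> together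
  with these limits.\<close>

definition next_pt :: "real \<Rightarrow> real" where
  "next_pt x = Inf {s \<in> SL. x \<le> s}"

lemma S_subset: "S \<subseteq> {0..<1} - hole x1 x2"
  and hole_map_image_S: "hole_map \<alpha> x1 x2 ` S = S"
  using invariant_off_hole_max_invariant_set[of \<alpha> x1 x2]
  by (auto simp: invariant_off_hole_def S_def)

lemma SL_add_int [simp]: "x + of_int m \<in> SL \<longleftrightarrow> x \<in> SL"
  by (simp add: SL_def frac_def)

lemma S_eq: "S = SL \<inter> {0..<1}"
  using S_subset by (auto simp: SL_def frac_eq[THEN iffD2])

lemma frac_mem_S [simp]: "frac x \<in> S \<longleftrightarrow> x \<in> SL"
  by (simp add: SL_def)

lemma SL_subset: "SL \<subseteq> off_hole"
proof
  fix x assume "x \<in> SL"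
  then have "frac x \<in> {0..<1} - hole x1 x2" using S_subset frac_mem_S[of x] by blast
  then show "x \<in> off_hole" by (auto simp: off_hole_def hole_def)
qed

lemma frac_lift_map_mem_S: "s \<in> S \<Longrightarrow> frac (lift_map s) \<in> S"
  using hole_map_image_S S_subset hole_map_eq_frac_lift_map by (metis image_eqI subsetD)

lemma lift_map_mem_SL:
  assumes "x \<in> SL"
  shows "lift_map x \<in> SL"
  using frac_lift_map_mem_S[of "frac x"] frac_lift_map_frac[of x] assms by simp

lemma frac_eqE:
  fixes x y :: real
  assumes "frac x = frac y"
  obtains m where "x = y + of_int m"
  using assms that[of "\<lfloor>x\<rfloor> - \<lfloor>y\<rfloor>"] by (simp add: frac_def algebra_simps)

lemma lift_map_surj_SL:
  assumes "y \<in> SL"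
  obtains x where "x \<in> SL" "lift_map x = y"
proof -
  have "frac y \<in> hole_map \<alpha> x1 x2 ` S"
    using assms hole_map_image_S by simp
  then obtain s where s: "s \<in> S" "frac y = hole_map \<alpha> x1 x2 s" by blast
  then have "frac y = frac (lift_map s)"
    using S_subset hole_map_eq_frac_lift_map by auto
  then obtain m where "y = lift_map s + of_int m" by (rule frac_eqE)
  then have "lift_map (s + of_int m) = y" by simp
  moreover have "s + of_int m \<in> SL" using s by (simp add: S_eq)
  ultimately show thesis using that by blast
qed

lemma ex_SL_ge: "\<exists>s\<in>SL. x \<le> s"
proof -
  obtain t where "t \<in> S" using S_nonempty by (auto simp: S_def)
  then have "t + of_int \<lceil>x\<rceil> \<in> SL" "x \<le> t + of_int \<lceil>x\<rceil>"
    by (auto simp: S_eq intro: add_increasing)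
  then show ?thesis by blast
qed

lemma bdd_below_SL_ge: "bdd_below {s \<in> SL. x \<le> s}"
  by (rule bdd_belowI[of _ x]) auto

lemma le_next_pt: "x \<le> next_pt x"
  unfolding next_pt_def using ex_SL_ge by (intro cInf_greatest) auto

lemma next_pt_le: "s \<in> SL \<Longrightarrow> x \<le> s \<Longrightarrow> next_pt x \<le> s"
  unfolding next_pt_def by (rule cInf_lower) (auto simp: bdd_below_SL_ge)

lemma next_pt_SL: "x \<in> SL \<Longrightarrow> next_pt x = x"
  by (intro antisym next_pt_le le_next_pt) auto

lemma next_pt_approx:
  assumes "0 < e"
  obtains s where "s \<in> SL" "next_pt x \<le> s" "x \<le> s" "s < next_pt x + e"
proof -
  have "Inf {s \<in> SL. x \<le> s} < next_pt x + e" using assms by (simp add: next_pt_def)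
  then obtain s where "s \<in> {s \<in> SL. x \<le> s}" "s < next_pt x + e"
    using ex_SL_ge[of x] by (subst (asm) cInf_less_iff) (auto simp: bdd_below_SL_ge)
  then show thesis using that next_pt_le by auto
qed

lemma next_pt_greatest: "(\<And>s. s \<in> SL \<Longrightarrow> x \<le> s \<Longrightarrow> z \<le> s) \<Longrightarrow> z \<le> next_pt x"
  unfolding next_pt_def using ex_SL_ge by (intro cInf_greatest) auto

lemma next_pt_mono: "x \<le> y \<Longrightarrow> next_pt x \<le> next_pt y"
  by (rule next_pt_greatest) (auto intro: next_pt_le)

lemma next_pt_add_int [simp]: "next_pt (x + of_int m) = next_pt x + of_int m"
proof -
  have "next_pt (x + of_int m) \<le> next_pt x + of_int m" for x m
  proof (rule field_le_epsilon)
    fix e :: real assume "0 < e"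
    then obtain s where s: "s \<in> SL" "x \<le> s" "s < next_pt x + e" by (metis next_pt_approx)
    then have "next_pt (x + of_int m) \<le> s + of_int m" by (intro next_pt_le) auto
    then show "next_pt (x + of_int m) \<le> next_pt x + of_int m + e" using s by linarith
  qed
  from this[of x m] this[of "x + of_int m" "-m"] show ?thesis by simp
qed

lemma next_pt_next_pt: "next_pt (next_pt x) = next_pt x"
proof (rule antisym[OF field_le_epsilon le_next_pt])
  fix e :: real assume "0 < e"
  then obtain s where "s \<in> SL" "next_pt x \<le> s" "s < next_pt x + e" by (metis next_pt_approx)
  then show "next_pt (next_pt x) \<le> next_pt x + e" using next_pt_le[of s "next_pt x"] by linarith
qed

lemma next_pt_eq_on_gap:
  assumes "x \<le> y" "\<And>s. s \<in> SL \<Longrightarrow> x \<le> s \<Longrightarrow> y \<le> s"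
  shows "next_pt x = next_pt y"
  by (intro antisym next_pt_mono assms next_pt_greatest next_pt_le)

lemma next_pt_hole:
  assumes "x1 \<le> x" "x \<le> x2"
  shows "next_pt x = next_pt x2"
proof (rule next_pt_eq_on_gap)
  fix s assume s: "s \<in> SL" "x \<le> s"
  show "x2 \<le> s"
  proof (rule ccontr)
    assume "\<not> x2 \<le> s"
    then have "frac s = s" using s assms params by (simp add: frac_eq)
    then show False using s SL_subset assms \<open>\<not> x2 \<le> s\<close> by (auto simp: off_hole_def)
  qed
qed (use assms in auto)

lemma next_pt_fixed_off_hole:
  assumes "next_pt x = x"
  shows "x \<in> off_hole"
proof (rule ccontr)
  assume "x \<notin> off_hole"
  then have x: "x1 \<le> frac x" "frac x < x2" by (auto simp: off_hole_def)
  have "next_pt (frac x) = next_pt x2" using x by (intro next_pt_hole) auto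
  moreover have "next_pt (frac x) = frac x"
    using next_pt_add_int[of "frac x" "\<lfloor>x\<rfloor>"] assms by (simp add: frac_def)
  ultimately show False using le_next_pt[of x2] x by simp
qed

text \<open>By right continuity, points of \<open>SL\<close> close to \<open>x\<close> on the right
  are sent to points of \<open>SL\<close> close to the image on the right.\<close>

lemma next_pt_fixed_lift_map:
  assumes "next_pt x = x"
  shows "next_pt (lift_map x) = lift_map x"
proof (rule antisym[OF field_le_epsilon le_next_pt])
  fix e :: real assume e: "0 < e"
  obtain d where d: "0 < d" "\<And>y. x \<le> y \<Longrightarrow> y < x + d \<Longrightarrow> lift_map y \<le> lift_map x + (y - x)"
    using lift_map_right_cont by blast
  obtain s where s: "s \<in> SL" "x \<le> s" "s < x + min d e"
    using next_pt_approx[of "min d e" x] e d assms by (metis min_less_iff_conj)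
  have "next_pt (lift_map x) \<le> lift_map s"
    using s by (intro next_pt_le lift_map_mem_SL lift_map_mono)
  also have "\<dots> \<le> lift_map x + e" using d(2)[of s] s by linarith
  finally show "next_pt (lift_map x) \<le> lift_map x + e" .
qed

lemma next_pt_fixed_preimage:
  assumes "next_pt x = x"
  obtains y where "next_pt y = y" "lift_map y = x"
proof -
  \<comment> \<open>The preimage is the leftmost limit of points of \<open>SL\<close> sent to
    \<open>x\<close> or beyond. Surjectivity on \<open>SL\<close> bounds its image above by
    \<open>x\<close>, right continuity bounds it below.\<close>
  define A where "A = {s \<in> SL. x \<le> lift_map s}"
  define y where "y = Inf A"
  have bdd: "bdd_below A"
  proof (rule bdd_belowI[of _ "x - 2"])
    fix s assume "s \<in> A"
    then show "x - 2 \<le> s" using lift_map_le[of s] by (simp add: A_def)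
  qed
  obtain s0 where "s0 \<in> SL" "x \<le> s0" using ex_SL_ge by blast
  then have ne: "A \<noteq> {}" using lift_map_ge[of s0] by (auto simp: A_def)
  have y_le: "y \<le> s" if "s \<in> SL" "x \<le> lift_map s" for s
    unfolding y_def using that bdd by (intro cInf_lower) (auto simp: A_def)
  have y_approx: "\<exists>s\<in>SL. x \<le> lift_map s \<and> s < y + e" if "0 < e" for e
  proof -
    have "Inf A < y + e" using that by (simp add: y_def)
    then show ?thesis using ne bdd by (subst (asm) cInf_less_iff) (auto simp: A_def)
  qed
  have "next_pt y = y"
  proof (rule antisym[OF field_le_epsilon le_next_pt])
    fix e :: real assume "0 < e"
    then obtain s where "s \<in> SL" "x \<le> lift_map s" "s < y + e" using y_approx by blast
    then show "next_pt y \<le> y + e" using next_pt_le[of s y] y_le[of s] by linarith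
  qed
  moreover have "lift_map y \<le> x"
  proof (rule field_le_epsilon)
    fix e :: real assume "0 < e"
    then obtain t where t: "t \<in> SL" "x \<le> t" "t < x + e" using assms by (metis next_pt_approx)
    then obtain s where s: "s \<in> SL" "lift_map s = t" by (meson lift_map_surj_SL)
    then have "lift_map y \<le> t" using t y_le[of s] lift_map_mono[of y s] by simp
    then show "lift_map y \<le> x + e" using t by simp
  qed
  moreover have "x \<le> lift_map y"
  proof (rule field_le_epsilon)
    fix e :: real assume e: "0 < e"
    obtain d where d: "0 < d" "\<And>z. y \<le> z \<Longrightarrow> z < y + d \<Longrightarrow> lift_map z \<le> lift_map y + (z - y)"
      using lift_map_right_cont by blast
    obtain s where s: "s \<in> SL" "x \<le> lift_map s" "s < y + min d e"
      using y_approx[of "min d e"] e d by auto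
    have "lift_map s \<le> lift_map y + e" using d(2)[of s] s y_le[of s] by linarith
    then show "x \<le> lift_map y + e" using s by linarith
  qed
  ultimately show thesis using that by auto
qed

text \<open>By maximality, the points of \<open>[0,1)\<close> that are limits of \<open>S\<close> from the right belong to \<open>S\<close>,
  since they form an invariant set.\<close>

lemma next_pt_mem_SL: "next_pt x \<in> SL"
proof -
  define T where "T = {t \<in> {0..<1}. next_pt t = t}"
  have T_iff: "frac z \<in> T \<longleftrightarrow> next_pt z = z" for z
    using next_pt_add_int[of "frac z" "\<lfloor>z\<rfloor>"] frac_lt_1[of z]
    by (auto simp: T_def frac_def)
  have T_off: "T \<subseteq> {0..<1} - hole x1 x2"
    using next_pt_fixed_off_hole by (force simp: T_def off_hole_def hole_def frac_eq[THEN iffD2])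
  have "hole_map \<alpha> x1 x2 ` T = (\<lambda>t. frac (lift_map t)) ` T"
    using T_off hole_map_eq_frac_lift_map by (intro image_cong) auto
  also have "\<dots> = T"
  proof (intro equalityI subsetI)
    fix z assume "z \<in> (\<lambda>t. frac (lift_map t)) ` T"
    then obtain t where "next_pt t = t" "z = frac (lift_map t)" by (auto simp: T_def)
    then show "z \<in> T" using T_iff next_pt_fixed_lift_map by blast
  next
    fix z assume z: "z \<in> T"
    then have "next_pt z = z" by (simp add: T_def)
    then obtain y where y: "next_pt y = y" "lift_map y = z"
      by (rule next_pt_fixed_preimage)
    have "frac (lift_map (frac y)) = z"
      using y z by (simp add: frac_lift_map_frac T_def frac_eq)
    moreover have "frac y \<in> T" using y by (simp add: T_iff)
    ultimately show "z \<in> (\<lambda>t. frac (lift_map t)) ` T" by blast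
  qed
  finally have "T \<subseteq> S"
    unfolding S_def using T_off by (intro max_invariant_set_greatest) (simp add: invariant_off_hole_def)
  then have "frac (next_pt x) \<in> S" using T_iff[of "next_pt x"] next_pt_next_pt[of x] by auto
  then show ?thesis by simp
qed

lemma SL_eq_fixed: "SL = {x. next_pt x = x}"
proof (intro equalityI subsetI)
  fix x assume "x \<in> {x. next_pt x = x}"
  then show "x \<in> SL" using next_pt_mem_SL[of x] by simp
qed (simp add: next_pt_SL)

lemma next_pt_measurable [measurable]: "next_pt \<in> borel_measurable borel"
  by (rule borel_measurable_mono) (simp add: mono_def next_pt_mono)

text \<open>Measurability follows from the description as fixed points of a monotone function, so
  the structure as a union of intervals need not be established first.\<close>

lemma SL_borel [measurable]: "SL \<in> sets borel"
  unfolding SL_eq_fixed by measurable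

text \<open>This is why gaps go to gaps. For the lower bound, a preimage in \<open>SL\<close> of the
  right end cannot lie to the left of \<open>x\<close>, by strict monotonicity.\<close>

lemma next_pt_lift_map: "next_pt (lift_map x) = lift_map (next_pt x)"
proof (rule antisym)
  show "next_pt (lift_map x) \<le> lift_map (next_pt x)"
    by (intro next_pt_le lift_map_mem_SL next_pt_mem_SL lift_map_mono le_next_pt)
  obtain s where s: "s \<in> SL" "lift_map s = next_pt (lift_map x)"
    by (rule lift_map_surj_SL[OF next_pt_mem_SL])
  have "\<not> s < x"
    using lift_map_strict_mono[of s x] s SL_subset le_next_pt[of "lift_map x"] by auto
  then show "lift_map (next_pt x) \<le> next_pt (lift_map x)"
    using s next_pt_le[of s x] lift_map_mono[of "next_pt x" s] by simp
qed

text \<open>Each point of \<open>SL\<close> is the image of a point off the hole: a negative one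
  lands below \<alpha>, a nonnegative one at or beyond \<open>lift_map 0\<close>.\<close>

lemma SL_avoids_range_gap:
  assumes "s \<in> SL" "\<alpha> \<le> s"
  shows "\<alpha> + (x2 - x1) \<le> s"
proof -
  obtain t where t: "t \<in> SL" "lift_map t = s" using assms(1) by (rule lift_map_surj_SL)
  then have "\<not> t < 0" using lift_map_neg[of t] SL_subset assms by auto
  then show ?thesis using lift_map_mono[of 0 t] t lift_map_0 by simp
qed

end

section \<open>Measure of periodic sets on intervals\<close>

lemma borel_Int_lmeasurable:
  fixes A :: "real set"
  assumes "A \<in> sets borel"
  shows "A \<inter> {a..<b} \<in> lmeasurable"
  using assms by (intro fmeasurableI2[OF lmeasurable_interval(1)[of a b]]) auto

lemma lmeasurable_atLeastLessThan: "{a..<b::real} \<in> lmeasurable"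
  using borel_Int_lmeasurable[of UNIV a b] by simp

lemma measure_Int_split:
  fixes A :: "real set"
  assumes "A \<in> sets borel" "a \<le> b" "b \<le> c"
  shows "measure lebesgue (A \<inter> {a..<c}) =
    measure lebesgue (A \<inter> {a..<b}) + measure lebesgue (A \<inter> {b..<c})"
proof -
  have eq: "A \<inter> {a..<c} = (A \<inter> {a..<b}) \<union> (A \<inter> {b..<c})" using assms by auto
  have "(A \<inter> {a..<b}) \<inter> (A \<inter> {b..<c}) = {}" by auto
  then show ?thesis
    unfolding eq using assms by (subst measure_Un3) (auto intro: borel_Int_lmeasurable simp del: Int_Un_distrib)
qed

lemma measure_Int_periodic_shift:
  fixes A :: "real set"
  assumes "\<And>x. x + 1 \<in> A \<longleftrightarrow> x \<in> A"
  shows "measure lebesgue (A \<inter> {1 + a..<1 + b}) = measure lebesgue (A \<inter> {a..<b})"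
proof -
  have "A \<inter> {1 + a..<1 + b} = (+) 1 ` (A \<inter> {a..<b})"
  proof (intro equalityI subsetI)
    fix y assume "y \<in> A \<inter> {1 + a..<1 + b}"
    then have "y - 1 \<in> A \<inter> {a..<b}" "y = 1 + (y - 1)" using assms[of "y - 1"] by auto
    then show "y \<in> (+) 1 ` (A \<inter> {a..<b})" by blast
  qed (use assms in \<open>auto simp: add.commute\<close>)
  then show ?thesis by (simp add: measure_translation)
qed

lemma measure_Int_periodic:
  fixes A :: "real set"
  assumes "A \<in> sets borel" "\<And>x. x + 1 \<in> A \<longleftrightarrow> x \<in> A" "0 \<le> u" "u \<le> 1"
  shows "measure lebesgue (A \<inter> {u..<1 + u}) = measure lebesgue (A \<inter> {0..<1})"
  using measure_Int_split[of A u 1 "1 + u"] measure_Int_split[of A 0 u 1]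
    measure_Int_periodic_shift[of A 0 u] assms by simp

section \<open>Conjugation to a rotation by cumulative measure\<close>

context holed_rotation_nonempty
begin

lemma S_lmeasurable: "S \<in> lmeasurable"
  unfolding S_eq by (simp add: borel_Int_lmeasurable)

text \<open>The map Y before normalisation and reduction modulo 1, extended to the half-line; for
  negative arguments the interval is empty and the value 0.\<close>

definition cum :: "real \<Rightarrow> real" where
  "cum x = measure lebesgue (SL \<inter> {0..<x})"

lemma cum_1: "cum 1 = measure lebesgue S"
  by (simp add: cum_def S_eq)

lemma squeeze_map_eq: "squeeze_map S \<alpha> = frac (cum \<alpha> / cum 1)"
proof -
  have "S \<inter> {0..<\<alpha>} = SL \<inter> {0..<\<alpha>}" using alpha_less_1 by (auto simp: S_eq)
  then show ?thesis by (simp add: squeeze_map_def cum_1) (simp add: cum_def)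
qed

lemma cum_nonneg: "0 \<le> cum x"
  by (simp add: cum_def)

lemma cum_mono: "x \<le> y \<Longrightarrow> cum x \<le> cum y"
  unfolding cum_def
  by (intro measure_mono_fmeasurable borel_Int_lmeasurable fmeasurableD[OF borel_Int_lmeasurable]) auto

lemma cum_add_nat: "0 \<le> x \<Longrightarrow> cum (x + of_nat n) = cum x + of_nat n * cum 1"
proof (induction n)
  case (Suc n)
  have "cum (1 + (x + of_nat n)) = cum 1 + cum (x + of_nat n)"
    unfolding cum_def using Suc.prems SL_add_int[of _ 1] measure_Int_periodic_shift[of SL 0 "x + of_nat n"]
    by (subst measure_Int_split[of SL 0 1]) auto
  then show ?case using Suc by (simp add: algebra_simps)
qed simp

lemma lift_map_image_SL:
  assumes "s \<in> SL" "0 \<le> s"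
  shows "lift_map ` (SL \<inter> {0..<s}) = SL \<inter> {\<alpha>..<lift_map s}"
proof (intro equalityI subsetI)
  fix y assume "y \<in> lift_map ` (SL \<inter> {0..<s})"
  then obtain x where x: "x \<in> SL" "0 \<le> x" "x < s" "y = lift_map x" by auto
  then show "y \<in> SL \<inter> {\<alpha>..<lift_map s}"
    using lift_map_mono[of 0 x] lift_map_0 x1_less_x2 lift_map_strict_mono[of x s] SL_subset
      lift_map_mem_SL[of x] by auto
next
  fix y assume y: "y \<in> SL \<inter> {\<alpha>..<lift_map s}"
  then obtain x where x: "x \<in> SL" "lift_map x = y" by (auto elim: lift_map_surj_SL)
  then have "0 \<le> x" using lift_map_neg[of x] SL_subset y by force
  moreover have "x < s" using x y lift_map_mono[of s x] by force
  ultimately show "y \<in> lift_map ` (SL \<inter> {0..<s})" using x by auto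
qed

text \<open>The part of \<open>SL\<close> in \<open>{0..<s}\<close> is carried, with its measure,
  onto the part between \<alpha> and \<open>lift_map s\<close>. So \<open>cum\<close> turns the lift
  into a translation.\<close>

lemma cum_lift_map:
  assumes "s \<in> SL" "0 \<le> s"
  shows "cum (lift_map s) = cum s + cum \<alpha>"
proof -
  have "\<alpha> \<le> lift_map s"
    using lift_map_mono[of 0 s] lift_map_0 x1_less_x2 assms by simp
  then have "cum (lift_map s) = cum \<alpha> + measure lebesgue (SL \<inter> {\<alpha>..<lift_map s})"
    unfolding cum_def using alpha_nonneg by (intro measure_Int_split) auto
  also have "measure lebesgue (SL \<inter> {\<alpha>..<lift_map s}) = cum s"
    unfolding cum_def lift_map_image_SL[OF assms, symmetric] using SL_subset
    by (intro measure_lift_map_image borel_Int_lmeasurable) auto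
  finally show ?thesis by simp
qed

definition circle_map :: "real \<Rightarrow> real" where
  "circle_map x = frac (lift_map x)"

lemma frac_lift_map_eq: "frac (lift_map x) = circle_map (frac x)"
  by (simp add: circle_map_def frac_lift_map_frac)

lemma circle_map_mem_S: "s \<in> S \<Longrightarrow> circle_map s \<in> S"
  unfolding circle_map_def by (rule frac_lift_map_mem_S)

lemma funpow_circle_map_mem_S: "s \<in> S \<Longrightarrow> (circle_map ^^ n) s \<in> S"
  by (induction n) (auto intro: circle_map_mem_S)

lemma funpow_lift_map_mem_SL: "s \<in> SL \<Longrightarrow> (lift_map ^^ n) s \<in> SL"
  by (induction n) (auto intro: lift_map_mem_SL)

lemma funpow_lift_map_ge: "s \<le> (lift_map ^^ n) s"
  by (induction n) (auto intro: order_trans lift_map_ge)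

lemma funpow_circle_map: "s \<in> S \<Longrightarrow> (circle_map ^^ n) s = frac ((lift_map ^^ n) s)"
  by (induction n) (auto simp: frac_lift_map_eq frac_eq S_eq)

lemma cum_funpow_lift_map:
  assumes "s \<in> SL" "0 \<le> s"
  shows "cum ((lift_map ^^ n) s) = cum s + of_nat n * cum \<alpha>"
proof (induction n)
  case (Suc n)
  have "cum (lift_map ((lift_map ^^ n) s)) = cum ((lift_map ^^ n) s) + cum \<alpha>"
    using assms order_trans[OF assms(2) funpow_lift_map_ge]
    by (intro cum_lift_map funpow_lift_map_mem_SL)
  then show ?case using Suc by (simp add: algebra_simps)
qed simp

lemma lift_map_mod_1_inj:
  assumes "x \<in> SL" "y \<in> SL" "frac (lift_map x) = frac (lift_map y)"
  shows "frac x = frac y"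
proof -
  obtain m where m: "lift_map x = lift_map y + of_int m"
    using assms(3) by (rule frac_eqE)
  have "x \<in> off_hole" "y + of_int m \<in> off_hole" using assms SL_subset by auto
  then have "x = y + of_int m"
    using m by (auto intro: inj_onD[OF inj_on_lift_map])
  then show ?thesis by (simp add: frac_def)
qed

lemma inj_on_circle_map: "inj_on circle_map S"
proof (rule inj_onI)
  fix x y assume xy: "x \<in> S" "y \<in> S" "circle_map x = circle_map y"
  then have "frac x = frac y" by (rule_tac lift_map_mod_1_inj) (auto simp: circle_map_def S_eq)
  moreover have "frac x = x" "frac y = y" using xy by (auto simp: S_eq frac_eq)
  ultimately show "x = y" by simp
qed

lemma funpow_circle_map_inj:
  "s \<in> S \<Longrightarrow> t \<in> S \<Longrightarrow> (circle_map ^^ n) s = (circle_map ^^ n) t \<Longrightarrow> s = t"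
  by (induction n) (auto dest: inj_onD[OF inj_on_circle_map] intro: funpow_circle_map_mem_S)

section \<open>Lengths of gaps and their change under the map\<close>

definition gap :: "real \<Rightarrow> real set" where
  "gap s = {y. frac (next_pt y) = s}"

text \<open>A point \<open>s\<close> of \<open>S\<close> always lies in \<open>gap s\<close>; length
  0 thus encodes that no proper gap ends there.\<close>

definition gap_length :: "real \<Rightarrow> real" where
  "gap_length s = measure lebesgue (gap s \<inter> {0..<1})"

lemma gap_borel [measurable]: "gap s \<in> sets borel"
  unfolding gap_def frac_def by measurable

lemma gap_add_1: "x + 1 \<in> gap s \<longleftrightarrow> x \<in> gap s"
  using next_pt_add_int[of x 1] by (simp add: gap_def frac_def)

definition hole_end :: real where
  "hole_end = frac (next_pt x2)"

definition zero_end :: real where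
  "zero_end = frac (next_pt 0)"

lemma zero_end_mem_S: "zero_end \<in> S"
  by (simp add: zero_end_def next_pt_mem_SL)

lemma gap_Int_hole:
  "gap s \<inter> {x1..<x2} = (if s = hole_end then {x1..<x2} else {})"
proof -
  have "frac (next_pt y) = hole_end" if "y \<in> {x1..<x2}" for y
    using next_pt_hole[of y] that by (simp add: hole_end_def)
  then show ?thesis by (auto simp: gap_def)
qed

text \<open>The interval missed by the range ends at \<open>lift_map 0\<close>, so it belongs to the
  gap that follows the one around 0; injectivity of \<open>circle_map\<close> excludes any other
  \<open>s\<close>.\<close>

lemma gap_Int_range_gap:
  assumes "s \<in> S"
  shows "gap (circle_map s) \<inter> {\<alpha>..<\<alpha> + (x2 - x1)} =
    (if s = zero_end then {\<alpha>..<\<alpha> + (x2 - x1)} else {})"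
proof -
  have "next_pt y = lift_map (next_pt 0)" if "y \<in> {\<alpha>..<\<alpha> + (x2 - x1)}" for y
  proof -
    have "next_pt y = next_pt (\<alpha> + (x2 - x1))"
      using that SL_avoids_range_gap by (intro next_pt_eq_on_gap) auto
    then show ?thesis by (metis lift_map_0 next_pt_lift_map)
  qed
  then have *: "frac (next_pt y) = circle_map zero_end" if "y \<in> {\<alpha>..<\<alpha> + (x2 - x1)}" for y
    using that by (simp add: zero_end_def frac_lift_map_eq)
  have "circle_map zero_end = circle_map s \<longleftrightarrow> s = zero_end"
    using inj_on_circle_map assms zero_end_mem_S by (auto dest: inj_onD)
  then show ?thesis using * by (auto simp: gap_def)
qed

lemma lift_map_image_gap:
  assumes "s \<in> S"
  shows "lift_map ` (gap s \<inter> {0..<1} \<inter> off_hole) =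
    gap (circle_map s) \<inter> {\<alpha> + (x2 - x1)..<1 + \<alpha>}"
proof (intro equalityI subsetI)
  fix z assume "z \<in> lift_map ` (gap s \<inter> {0..<1} \<inter> off_hole)"
  then obtain y where y: "y \<in> gap s" "0 \<le> y" "y < 1" "y \<in> off_hole" "z = lift_map y" by auto
  have "frac (next_pt z) = circle_map s"
    using y by (simp add: next_pt_lift_map frac_lift_map_eq gap_def)
  moreover have "z < 1 + \<alpha>"
    using y params by (auto simp: lift_map_def off_hole_def frac_eq[THEN iffD2])
  moreover have "\<alpha> + (x2 - x1) \<le> z" using y lift_map_mono[of 0 y] lift_map_0 by simp
  ultimately show "z \<in> gap (circle_map s) \<inter> {\<alpha> + (x2 - x1)..<1 + \<alpha>}" by (simp add: gap_def)
next
  fix z assume z: "z \<in> gap (circle_map s) \<inter> {\<alpha> + (x2 - x1)..<1 + \<alpha>}"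
  \<comment> \<open>Inverse of the two branches: images from the left of the hole end at
    \<open>\<alpha> + x2\<close>, where those from its right begin.\<close>
  define y where "y = (if z < \<alpha> + x2 then z - (\<alpha> + (x2 - x1)) else z - \<alpha>)"
  have y: "0 \<le> y" "y < 1" using z params by (auto simp: y_def)
  then have fy: "frac y = y" by (simp add: frac_eq)
  have "y \<in> off_hole" "lift_map y = z"
    using z params by (auto simp: off_hole_def lift_map_def fy) (auto simp: y_def split: if_splits)
  moreover have "frac (next_pt y) = s"
  proof -
    have "frac (lift_map (next_pt y)) = frac (lift_map s)"
      using z \<open>lift_map y = z\<close> by (auto simp: gap_def circle_map_def next_pt_lift_map[symmetric])
    then have "frac (next_pt y) = frac s"
      using assms by (rule_tac lift_map_mod_1_inj[OF next_pt_mem_SL]) (auto simp: S_eq)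
    then show ?thesis using assms by (simp add: S_eq frac_eq[THEN iffD2])
  qed
  ultimately show "z \<in> lift_map ` (gap s \<inter> {0..<1} \<inter> off_hole)" using y by (auto simp: gap_def)
qed

text \<open>The first correction is the complement of the range, which is inserted where 0 is mapped to;
  the second is the hole, which is cut out.\<close>

lemma gap_length_circle_map:
  assumes "s \<in> S"
  shows "gap_length (circle_map s) = gap_length s
    + (if s = zero_end then x2 - x1 else 0) - (if s = hole_end then x2 - x1 else 0)"
proof -
  let ?B = "gap (circle_map s)"
  have off: "gap s \<inter> {0..<1} \<inter> off_hole \<in> lmeasurable" "gap s \<inter> {0..<1} \<inter> off_hole \<in> sets borel"
  proof -
    have "off_hole \<in> sets borel" unfolding off_hole_def frac_def by measurable
    then show "gap s \<inter> {0..<1} \<inter> off_hole \<in> sets borel" by measurable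
    then show "gap s \<inter> {0..<1} \<inter> off_hole \<in> lmeasurable"
      by (rule_tac fmeasurableI2[OF borel_Int_lmeasurable[OF gap_borel, of s 0 1]]) auto
  qed
  \<comment> \<open>The period is started at \<alpha>, so that the interval missed by the range
    comes first and the image of \<open>{0..<1}\<close> lies in the rest.\<close>
  have "gap_length (circle_map s) = measure lebesgue (?B \<inter> {\<alpha>..<1 + \<alpha>})"
    unfolding gap_length_def using alpha_nonneg alpha_less_1 gap_add_1
    by (intro measure_Int_periodic[symmetric]) auto
  also have "\<dots> = measure lebesgue (?B \<inter> {\<alpha>..<\<alpha> + (x2 - x1)})
      + measure lebesgue (?B \<inter> {\<alpha> + (x2 - x1)..<1 + \<alpha>})"
    using params by (intro measure_Int_split) auto
  also have "measure lebesgue (?B \<inter> {\<alpha> + (x2 - x1)..<1 + \<alpha>}) =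
      measure lebesgue (gap s \<inter> {0..<1} \<inter> off_hole)"
    unfolding lift_map_image_gap[OF assms, symmetric] using off by (intro measure_lift_map_image) auto
  finally have 1: "gap_length (circle_map s) = (if s = zero_end then x2 - x1 else 0)
      + measure lebesgue (gap s \<inter> {0..<1} \<inter> off_hole)"
    using x1_less_x2 by (simp add: gap_Int_range_gap[OF assms])
  have "gap s \<inter> {0..<1} = (gap s \<inter> {0..<1} \<inter> off_hole) \<union> (gap s \<inter> {x1..<x2})"
    using params by (auto simp: off_hole_def frac_eq[THEN iffD2])
  moreover have "(gap s \<inter> {0..<1} \<inter> off_hole) \<inter> (gap s \<inter> {x1..<x2}) = {}"
    using params by (auto simp: off_hole_def frac_eq[THEN iffD2])
  ultimately have "gap_length s = measure lebesgue (gap s \<inter> {0..<1} \<inter> off_hole)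
      + measure lebesgue (gap s \<inter> {x1..<x2})"
    unfolding gap_length_def using off borel_Int_lmeasurable[OF gap_borel, of s x1 x2]
    by (metis diff_zero measure_Un3 measure_empty)
  then show ?thesis using 1 x1_less_x2 by (simp add: gap_Int_hole)
qed

lemma gap_length_nonneg: "0 \<le> gap_length s"
  by (simp add: gap_length_def)

lemma gap_length_hole_end: "x2 - x1 \<le> gap_length hole_end"
proof -
  have "measure lebesgue (gap hole_end \<inter> {x1..<x2}) \<le> gap_length hole_end"
    unfolding gap_length_def using params
    by (intro measure_mono_fmeasurable borel_Int_lmeasurable fmeasurableD[OF borel_Int_lmeasurable]) auto
  then show ?thesis using x1_less_x2 by (simp add: gap_Int_hole)
qed

lemma measure_UN_gaps:
  assumes "finite I"
  shows "measure lebesgue (\<Union>s\<in>I. gap s \<inter> {0..<1}) = (\<Sum>s\<in>I. gap_length s)"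
proof -
  have "pairwise (\<lambda>s t. disjnt (gap s \<inter> {0..<1}) (gap t \<inter> {0..<1})) I"
    by (auto simp: pairwise_def disjnt_def gap_def)
  then show ?thesis
    unfolding gap_length_def using assms by (intro measure_UNION' borel_Int_lmeasurable) auto
qed

lemma sum_gap_length_le_1:
  assumes "finite I"
  shows "(\<Sum>s\<in>I. gap_length s) \<le> 1"
proof -
  have "measure lebesgue (\<Union>s\<in>I. gap s \<inter> {0..<1}) \<le> measure lebesgue {0..<1::real}"
    using assms
    by (intro measure_mono_fmeasurable fmeasurableD[OF fmeasurable.finite_UN] borel_Int_lmeasurable
        lmeasurable_atLeastLessThan) auto
  then show ?thesis using measure_UN_gaps[OF assms] by simp
qed

lemma gap_length_next_pt_pos:
  assumes "y \<in> {0..<1}" "y \<notin> S"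
  shows "0 < gap_length (frac (next_pt y))"
proof -
  have "y \<noteq> next_pt y"
    using assms next_pt_mem_SL[of y] by (auto simp: S_eq)
  then have less: "y < next_pt y" using le_next_pt[of y] by simp
  \<comment> \<open>Cut at 1, since a gap may wrap around and its length is measured inside
    \<open>{0..<1}\<close>.\<close>
  let ?z = "min (next_pt y) 1"
  have "x \<in> gap (frac (next_pt y))" if "y \<le> x" "x < next_pt y" for x
  proof -
    have "next_pt y = next_pt x"
      using that next_pt_le by (intro next_pt_eq_on_gap) force+
    then show ?thesis by (simp add: gap_def)
  qed
  then have sub: "{y..<?z} \<subseteq> gap (frac (next_pt y)) \<inter> {0..<1}"
    using assms by auto
  have "0 < ?z - y" using less assms by simp
  also have "?z - y = measure lebesgue {y..<?z}" using less assms by simp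
  also have "\<dots> \<le> gap_length (frac (next_pt y))"
    unfolding gap_length_def using sub
    by (intro measure_mono_fmeasurable borel_Int_lmeasurable
        fmeasurableD[OF lmeasurable_atLeastLessThan]) auto
  finally show ?thesis .
qed

end

lemma funpow_apply_funpow: "(f ^^ m) ((f ^^ n) x) = (f ^^ (m + n)) x"
  by (simp add: funpow_add)

section \<open>Steps by multiples of \<open>b\<close> modulo 1, and the rational case\<close>

locale holed_rotation_translation = holed_rotation_nonempty +
  fixes b :: real
  assumes translation: "\<And>s. s \<in> SL \<Longrightarrow> \<exists>j::nat. \<exists>i::int. 1 \<le> j \<and> lift_map s = s + of_nat j * b + of_int i"
begin

text \<open>Each step contributes at least one \<open>b\<close>, so the multiple grows with
  \<open>n\<close>; this later turns a periodic point into a rational value of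
  \<open>b\<close>.\<close>

lemma funpow_translation:
  assumes "s \<in> SL"
  shows "\<exists>j::nat. \<exists>i::int. n \<le> j \<and> (lift_map ^^ n) s = s + of_nat j * b + of_int i"
proof (induction n)
  case 0
  show ?case by (rule exI[of _ 0], rule exI[of _ 0]) simp
next
  case (Suc n)
  then obtain j i where ji: "n \<le> j" "(lift_map ^^ n) s = s + of_nat j * b + of_int i" by blast
  obtain j' i' where "1 \<le> (j'::nat)"
      "lift_map ((lift_map ^^ n) s) = (lift_map ^^ n) s + of_nat j' * b + of_int i'"
    using translation funpow_lift_map_mem_SL[OF assms] by blast
  then have "Suc n \<le> j + j' \<and>
      (lift_map ^^ Suc n) s = s + of_nat (j + j') * b + of_int (i + i')"
    using ji by (simp add: algebra_simps)
  then show ?case by blast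
qed

text \<open>If \<open>b\<close> is rational, the orbit of a point of \<open>S\<close> is finite modulo 1, hence eventually periodic,
  and the period is also one of the conjugate rotation.\<close>

lemma squeeze_map_rational:
  assumes "b \<in> \<rat>"
  shows "squeeze_map S \<alpha> \<in> \<rat>"
\<comment> \<open>For \<open>cum 1 = 0\<close>, division by zero makes the quotient 0, which is
  rational.\<close>
proof (cases "cum 1 = 0")
  case False
  obtain s where "s \<in> S" using S_nonempty by (auto simp: S_def)
  then have s: "s \<in> SL" "0 \<le> s" by (auto simp: S_eq)
  obtain p :: int and q :: nat where q: "0 < q" and b: "b = of_int p / of_nat q"
    using assms by (metis Rats_cases' of_int_of_nat_eq zero_less_imp_eq_int of_nat_0_less_iff)
  \<comment> \<open>Displacements are multiples of \<open>1 / q\<close>; \<open>f n\<close> is the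
    numerator modulo \<open>q\<close>, and the pigeonhole principle gives two equal values.\<close>
  define f where "f n = \<lfloor>((lift_map ^^ n) s - s) * of_nat q\<rfloor> mod int q" for n
  have f: "((lift_map ^^ n) s - s) * of_nat q \<in> \<int>" for n
  proof -
    obtain j i where "(lift_map ^^ n) s = s + of_nat j * b + of_int i"
      using funpow_translation[OF s(1)] by blast
    then have "((lift_map ^^ n) s - s) * of_nat q = of_int (int j * p + i * int q)"
      using q by (simp add: b field_simps)
    then show ?thesis by (metis Ints_of_int)
  qed
  have "f ` UNIV \<subseteq> {0..<int q}" using q by (auto simp: f_def)
  then have "finite (range f)" using finite_subset by blast
  then have "\<not> inj f" using finite_imageD by blast
  then obtain m n where mn: "m < n" "f m = f n"
    by (metis injI linorder_neqE_nat)
  define u where "u = (lift_map ^^ m) s"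
  have "int q dvd \<lfloor>((lift_map ^^ n) s - s) * of_nat q\<rfloor> - \<lfloor>((lift_map ^^ m) s - s) * of_nat q\<rfloor>"
    using mn(2)[symmetric] by (simp add: f_def mod_eq_dvd_iff)
  then obtain k where "\<lfloor>((lift_map ^^ n) s - s) * of_nat q\<rfloor>
      = \<lfloor>((lift_map ^^ m) s - s) * of_nat q\<rfloor> + int q * k"
    by (auto simp: dvd_def algebra_simps)
  then have "of_int \<lfloor>((lift_map ^^ n) s - s) * of_nat q\<rfloor>
      = (of_int \<lfloor>((lift_map ^^ m) s - s) * of_nat q\<rfloor> + of_nat q * of_int k :: real)"
    by simp
  then have "((lift_map ^^ n) s - s) * of_nat q = ((lift_map ^^ m) s - s) * of_nat q + of_nat q * of_int k"
    using f[of n] f[of m] by simp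
  then have "of_nat q * ((lift_map ^^ n) s - (u + of_int k)) = 0"
    by (simp add: u_def algebra_simps)
  then have eq: "(lift_map ^^ n) s = u + of_int k" using q by simp
  have "u \<le> (lift_map ^^ n) s"
    using funpow_lift_map_ge[of u "n - m"] mn(1) by (simp add: u_def funpow_apply_funpow)
  then have k: "0 \<le> k" using eq by simp
  have "0 \<le> u" using funpow_lift_map_ge[of s m] s by (simp add: u_def)
  then have "cum (u + of_nat (nat k)) = cum u + of_nat (nat k) * cum 1" by (rule cum_add_nat)
  then have "cum s + of_nat n * cum \<alpha> = cum s + of_nat m * cum \<alpha> + of_int k * cum 1"
    using cum_funpow_lift_map[OF s] eq k by (metis of_int_of_nat_eq int_nat_eq u_def)
  then have "cum \<alpha> / cum 1 = of_int k / of_nat (n - m)"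
    using mn False by (simp add: field_simps of_nat_diff)
  then show ?thesis by (simp add: squeeze_map_eq frac_def)
qed (simp add: squeeze_map_eq)

end

section \<open>Irrational steps: aperiodicity, gap structure and positive measure\<close>

locale holed_rotation_irrational = holed_rotation_translation +
  assumes b_irrational: "b \<notin> \<rat>"
begin

lemma funpow_lift_map_aperiodic:
  assumes "s \<in> SL" "1 \<le> n"
  shows "(lift_map ^^ n) s \<noteq> s + of_int m"
proof
  assume eq: "(lift_map ^^ n) s = s + of_int m"
  obtain j i where ji: "n \<le> (j::nat)" "(lift_map ^^ n) s = s + of_nat j * b + of_int i"
    using funpow_translation[OF assms(1)] by blast
  then have "b = of_int (m - i) / of_nat j" using eq assms by (simp add: field_simps)
  then have "b \<in> \<rat>" by (metis Rats_divide Rats_of_int Rats_of_nat)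
  then show False using b_irrational by contradiction
qed

lemma funpow_circle_map_aperiodic:
  assumes "s \<in> S" "(circle_map ^^ m) s = (circle_map ^^ n) s"
  shows "m = n"
proof -
  have "\<not> i < j" if "(circle_map ^^ i) s = (circle_map ^^ j) s" for i j
  proof
    assume ij: "i < j"
    define t where "t = (circle_map ^^ i) s"
    have t: "t \<in> S" using assms by (simp add: t_def funpow_circle_map_mem_S)
    have "(circle_map ^^ (j - i)) ((circle_map ^^ i) s) = (circle_map ^^ j) s"
      using ij by (simp add: funpow_apply_funpow)
    then have "t = (circle_map ^^ (j - i)) t" using that by (simp add: t_def)
    then have "frac ((lift_map ^^ (j - i)) t) = frac t"
      using t by (simp add: funpow_circle_map S_eq frac_eq[THEN iffD2])
    then obtain m where "(lift_map ^^ (j - i)) t = t + of_int m" by (rule frac_eqE)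
    moreover have "1 \<le> j - i" "t \<in> SL" using ij t by (auto simp: S_eq)
    ultimately show False using funpow_lift_map_aperiodic by blast
  qed
  then show ?thesis using assms by (metis linorder_neqE_nat)
qed

text \<open>The points of the orbit are distinct, so their gaps are disjoint and have total length
  at most 1.\<close>

lemma gap_length_funpow_small:
  assumes "s \<in> S" "0 < \<delta>"
  shows "\<exists>i. gap_length ((circle_map ^^ i) s) < \<delta>"
proof (rule ccontr)
  assume "\<not> ?thesis"
  then have ge: "\<delta> \<le> gap_length ((circle_map ^^ i) s)" for i by (simp add: not_less)
  obtain n where n: "1 < of_nat n * \<delta>" using reals_Archimedean3[OF assms(2)] by blast
  let ?I = "(\<lambda>i. (circle_map ^^ i) s) ` {..<n}"
  have "of_nat n * \<delta> \<le> (\<Sum>i<n. gap_length ((circle_map ^^ i) s))"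
    using sum_bounded_below[of "{..<n}" \<delta>] ge by simp
  also have "\<dots> = (\<Sum>t\<in>?I. gap_length t)"
    using funpow_circle_map_aperiodic[OF assms(1)] by (subst sum.reindex) (auto intro: inj_onI)
  also have "\<dots> \<le> 1" by (rule sum_gap_length_le_1) simp
  finally show False using n by simp
qed

text \<open>Along the orbit of \<open>zero_end\<close> the length grows by \<open>x2 - x1\<close> at
  the first step and drops only at \<open>hole_end\<close>, which must be reached since lengths
  become small. Afterwards the length stays at \<open>gap_length zero_end\<close>, which is
  therefore 0.\<close>

lemma gap_structure:
  obtains N where "1 \<le> N" "(circle_map ^^ N) zero_end = hole_end"
    "\<And>n. 1 \<le> n \<Longrightarrow> n \<le> N \<Longrightarrow> gap_length ((circle_map ^^ n) zero_end) = x2 - x1"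
    "gap_length zero_end = 0"
proof -
  let ?q = "\<lambda>n. (circle_map ^^ n) zero_end"
  have q: "?q n \<in> S" for n by (rule funpow_circle_map_mem_S[OF zero_end_mem_S])
  have step: "gap_length (?q (Suc n)) = gap_length (?q n) + (if n = 0 then x2 - x1 else 0)
      - (if ?q n = hole_end then x2 - x1 else 0)" for n
    using gap_length_circle_map[OF q[of n]] funpow_circle_map_aperiodic[OF zero_end_mem_S, of n 0]
    by auto
  obtain N where N: "?q N = hole_end"
  proof (rule ccontr)
    assume "\<not> thesis"
    then have no: "?q n \<noteq> hole_end" for n using that by blast
    have "x2 - x1 \<le> gap_length (?q (Suc n))" for n
    proof (induction n)
      case 0
      show ?case using step[of 0] no[of 0] gap_length_nonneg[of zero_end] by simp
    next
      case (Suc n)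
      then show ?case using step[of "Suc n"] no[of "Suc n"] by simp
    qed
    moreover obtain i where "gap_length ((circle_map ^^ i) (?q 1)) < x2 - x1"
      using gap_length_funpow_small[OF q[of 1]] x1_less_x2 by (metis diff_gt_0_iff_gt)
    ultimately show False by (simp add: funpow_swap1 not_less[symmetric])
  qed
  have hole_iff: "?q n = hole_end \<longleftrightarrow> n = N" for n
    using N funpow_circle_map_aperiodic[OF zero_end_mem_S] by metis
  have len: "gap_length (?q n) = gap_length zero_end + (if 1 \<le> n then x2 - x1 else 0)
      - (if N < n then x2 - x1 else 0)" for n
  proof (induction n)
    case (Suc n)
    then show ?case using step[of n] hole_iff[of n] by auto
  qed simp
  have zero: "gap_length zero_end = 0"
  proof (rule ccontr)
    assume "gap_length zero_end \<noteq> 0"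
    then have "0 < gap_length zero_end" using gap_length_nonneg[of zero_end] by simp
    then obtain i where "gap_length ((circle_map ^^ i) (?q (Suc N))) < gap_length zero_end"
      using gap_length_funpow_small[OF q] by blast
    moreover have "(circle_map ^^ i) (?q (Suc N)) = ?q (i + Suc N)" by (rule funpow_apply_funpow)
    ultimately show False using len[of "i + Suc N"] by simp
  qed
  have "N \<noteq> 0"
  proof
    assume "N = 0"
    then have "gap_length hole_end = 0" using N zero by simp
    then show False using gap_length_hole_end x1_less_x2 by simp
  qed
  then show thesis using that[of N] N zero len by auto
qed

text \<open>The gap of \<open>s\<close> cannot shrink before its orbit meets
  \<open>hole_end\<close>, say first at time \<open>j\<close>. If \<open>N\<close> \<le>
  \<open>j\<close>, injectivity puts \<open>zero_end\<close>, of length 0, on the way; otherwise it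
  lets \<open>j\<close> common steps be cancelled.\<close>

lemma gap_in_list:
  assumes N: "(circle_map ^^ N) zero_end = hole_end" and zero: "gap_length zero_end = 0"
    and s: "s \<in> S" "0 < gap_length s"
  shows "\<exists>n. 1 \<le> n \<and> n \<le> N \<and> s = (circle_map ^^ n) zero_end"
proof -
  let ?s = "\<lambda>j. (circle_map ^^ j) s"
  have mono: "gap_length s \<le> gap_length (?s j)" if "\<And>i. i < j \<Longrightarrow> ?s i \<noteq> hole_end" for j
    using that
  proof (induction j)
    case (Suc j)
    then show ?case
      using gap_length_circle_map[OF funpow_circle_map_mem_S[OF s(1)], of j] x1_less_x2
      by (force simp: less_Suc_eq)
  qed simp
  have "\<exists>j. ?s j = hole_end"
    using gap_length_funpow_small[OF s] mono by (meson not_less)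
  then obtain j where j: "?s j = hole_end" "\<And>i. i < j \<Longrightarrow> ?s i \<noteq> hole_end"
    using exists_least_iff[of "\<lambda>j. ?s j = hole_end"] by blast
  have "j < N"
  proof (rule ccontr)
    assume "\<not> j < N"
    then have "(circle_map ^^ N) (?s (j - N)) = (circle_map ^^ N) zero_end"
      using N j by (simp add: funpow_apply_funpow)
    then have "?s (j - N) = zero_end"
      by (rule funpow_circle_map_inj[OF funpow_circle_map_mem_S[OF s(1)] zero_end_mem_S])
    then have "gap_length s \<le> 0" using mono[of "j - N"] j zero by simp
    then show False using s by simp
  qed
  then have "(circle_map ^^ j) s = (circle_map ^^ j) ((circle_map ^^ (N - j)) zero_end)"
    using N j by (simp add: funpow_apply_funpow)
  then have "s = (circle_map ^^ (N - j)) zero_end"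
    by (rule funpow_circle_map_inj[OF s(1) funpow_circle_map_mem_S[OF zero_end_mem_S]])
  then show ?thesis using \<open>j < N\<close> by (intro exI[of _ "N - j"]) auto
qed

text \<open>The complement of \<open>S\<close> consists of \<open>N\<close> gaps of length \<open>x2 - x1\<close>, and they cannot fill
  the circle because \<open>x2 - x1\<close> is irrational.\<close>

lemma measure_S_pos:
  assumes "0 < x1 \<Longrightarrow> x2 < 1 \<Longrightarrow> x2 - x1 \<notin> \<rat>"
  shows "0 < measure lebesgue S"
proof -
  obtain N where N: "1 \<le> N" "(circle_map ^^ N) zero_end = hole_end"
    and len: "\<And>n. 1 \<le> n \<Longrightarrow> n \<le> N \<Longrightarrow> gap_length ((circle_map ^^ n) zero_end) = x2 - x1"
    and zero: "gap_length zero_end = 0"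
    by (rule gap_structure) blast
  have ne: "zero_end \<noteq> hole_end"
    using N funpow_circle_map_aperiodic[OF zero_end_mem_S, of N 0] by auto
  \<comment> \<open>A hole that touches 0 or 1 would lie in the gap labelled by
    \<open>zero_end\<close>, so both ends of the hole are interior and the assumption
    applies.\<close>
  have "x1 \<noteq> 0"
    using ne next_pt_hole[of 0] x1_less_x2 by (auto simp: zero_end_def hole_end_def)
  moreover have "x2 \<noteq> 1"
    using ne next_pt_add_int[of 0 1] by (auto simp: zero_end_def hole_end_def frac_def)
  ultimately have irr: "x2 - x1 \<notin> \<rat>" using assms x1_nonneg x2_le_1 by simp
  let ?I = "(\<lambda>n. (circle_map ^^ n) zero_end) ` {1..N}"
  have "(\<Sum>s\<in>?I. gap_length s) = (\<Sum>n\<in>{1..N}. gap_length ((circle_map ^^ n) zero_end))"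
    using funpow_circle_map_aperiodic[OF zero_end_mem_S] by (subst sum.reindex) (auto intro: inj_onI)
  also have "\<dots> = of_nat N * (x2 - x1)" using len by simp
  finally have sum: "(\<Sum>s\<in>?I. gap_length s) = of_nat N * (x2 - x1)" .
  have "of_nat N * (x2 - x1) \<noteq> 1"
  proof
    assume "of_nat N * (x2 - x1) = 1"
    then have "x2 - x1 = 1 / of_nat N" using N by (simp add: field_simps)
    then show False using irr by simp
  qed
  moreover have "of_nat N * (x2 - x1) \<le> 1" using sum_gap_length_le_1[of ?I] sum by simp
  ultimately have less: "of_nat N * (x2 - x1) < 1" by simp
  have "{0..<1} \<subseteq> S \<union> (\<Union>s\<in>?I. gap s \<inter> {0..<1})"
  proof
    fix y :: real assume y: "y \<in> {0..<1}"
    show "y \<in> S \<union> (\<Union>s\<in>?I. gap s \<inter> {0..<1})"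
    proof (cases "y \<in> S")
      case False
      have "\<exists>n. 1 \<le> n \<and> n \<le> N \<and> frac (next_pt y) = (circle_map ^^ n) zero_end"
        using gap_length_next_pt_pos[OF y False] by (intro gap_in_list N zero) (simp_all add: next_pt_mem_SL)
      then show ?thesis using y by (auto simp: gap_def)
    qed simp
  qed
  moreover have UN: "(\<Union>s\<in>?I. gap s \<inter> {0..<1}) \<in> lmeasurable"
    by (intro fmeasurable.finite_UN borel_Int_lmeasurable) auto
  ultimately have "measure lebesgue {0..<1::real} \<le> measure lebesgue (S \<union> (\<Union>s\<in>?I. gap s \<inter> {0..<1}))"
    using S_lmeasurable by (intro measure_mono_fmeasurable fmeasurable.Un) auto
  also have "\<dots> \<le> measure lebesgue S + measure lebesgue (\<Union>s\<in>?I. gap s \<inter> {0..<1})"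
    using S_lmeasurable UN by (intro measure_Un_le fmeasurableD)
  also have "measure lebesgue (\<Union>s\<in>?I. gap s \<inter> {0..<1}) = of_nat N * (x2 - x1)"
    using measure_UN_gaps[of ?I] sum by simp
  finally show ?thesis using less by simp
qed

section \<open>Irrationality of the conjugate rotation\<close>

lemma funpow_lift_map_mono: "x \<le> y \<Longrightarrow> (lift_map ^^ n) x \<le> (lift_map ^^ n) y"
  by (induction n) (auto intro: lift_map_mono)

lemma funpow_lift_map_add_int: "(lift_map ^^ n) (x + of_int m) = (lift_map ^^ n) x + of_int m"
  by (induction n) auto

text \<open>For fixed \<open>n\<close> this leaves finitely many displacements; \<open>j\<close>
  counts the passages through the branch left of the hole.\<close>

lemma funpow_lift_map_displacement:
  assumes "s \<in> SL"
  shows "\<exists>j\<le>n. (lift_map ^^ n) s = s + of_nat n * \<alpha> + of_nat j * (x2 - x1)"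
proof (induction n)
  case (Suc n)
  then obtain j where j: "j \<le> n" "(lift_map ^^ n) s = s + of_nat n * \<alpha> + of_nat j * (x2 - x1)"
    by blast
  define t where "t = (lift_map ^^ n) s"
  have "t \<in> off_hole" using funpow_lift_map_mem_SL[OF assms] SL_subset by (auto simp: t_def)
  then have "lift_map t = t + \<alpha> \<or> lift_map t = t + \<alpha> + (x2 - x1)"
    using x1_less_x2 by (auto simp: lift_map_def off_hole_def)
  have Suc_eq: "(lift_map ^^ Suc n) s = lift_map t" by (simp add: t_def)
  have t_eq: "t = s + of_nat n * \<alpha> + of_nat j * (x2 - x1)" using j by (simp add: t_def)
  from \<open>lift_map t = t + \<alpha> \<or> lift_map t = t + \<alpha> + (x2 - x1)\<close> show ?case
  proof
    assume "lift_map t = t + \<alpha>"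
    then show ?thesis
      using j(1) Suc_eq t_eq by (intro exI[of _ j]) (simp del: funpow.simps add: algebra_simps)
  next
    assume "lift_map t = t + \<alpha> + (x2 - x1)"
    then show ?thesis
      using j(1) Suc_eq t_eq by (intro exI[of _ "Suc j"]) (simp del: funpow.simps add: algebra_simps)
  qed
qed simp

text \<open>If the conjugate rotation had order \<open>q\<close>, the displacements of the \<open>q\<close>-th iterate, corrected by
  an integer, would be bounded away from 0 and of constant sign, yet have bounded sums.\<close>

lemma squeeze_map_irrational:
  assumes "0 < measure lebesgue S"
  shows "squeeze_map S \<alpha> \<notin> \<rat>"
proof
  assume "squeeze_map S \<alpha> \<in> \<rat>"
  then have "frac (cum \<alpha> / cum 1) + of_int \<lfloor>cum \<alpha> / cum 1\<rfloor> \<in> \<rat>"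
    unfolding squeeze_map_eq by (intro Rats_add Rats_of_int)
  then have rat: "cum \<alpha> / cum 1 \<in> \<rat>" by (simp add: frac_def)
  have cum1: "0 < cum 1" using assms by (simp add: cum_1)
  obtain p q :: nat where q: "q \<noteq> 0" and "\<bar>cum \<alpha> / cum 1\<bar> = of_nat p / of_nat q"
    using Rats_abs_nat_div_natE[OF rat] by metis
  then have pq: "of_nat q * cum \<alpha> = of_nat p * cum 1"
    using cum1 cum_nonneg[of \<alpha>] by (simp add: field_simps)
  obtain s where "s \<in> S" using S_nonempty by (auto simp: S_def)
  then have s: "s \<in> SL" "0 \<le> s" by (auto simp: S_eq)
  \<comment> \<open>By \<open>pq\<close>, \<open>q\<close> steps advance \<open>cum\<close> by
    exactly \<open>p\<close> periods; subtracting these periods should leave the points near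
    \<open>s\<close>.\<close>
  define z where "z n = (lift_map ^^ (n * q)) s - of_nat (n * p)" for n
  have z_SL: "z n \<in> SL" for n
    using SL_add_int[of "(lift_map ^^ (n * q)) s" "- int (n * p)"] funpow_lift_map_mem_SL[OF s(1)]
    by (simp add: z_def)
  have z_Suc: "z (Suc n) = (lift_map ^^ q) (z n) - of_nat p" for n
    using funpow_lift_map_add_int[of q "(lift_map ^^ (n * q)) s" "- int (n * p)"]
    by (simp add: z_def funpow_add)
  have cum_z: "cum (z n + of_nat (n * p)) = cum (s + of_nat (n * p))" for n
    using cum_funpow_lift_map[OF s, of "n * q"] cum_add_nat[OF s(2), of "n * p"] pq
    by (simp add: z_def algebra_simps)
  have z_bounded: "\<bar>z n - s\<bar> \<le> 1" for n
  proof -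
    \<comment> \<open>A full period strictly raises \<open>cum\<close>, so points with equal
      \<open>cum\<close> are less than 1 apart.\<close>
    have less: "cum x < cum y" if "0 \<le> x" "x + 1 \<le> y" for x y
      using cum_add_nat[OF that(1), of 1] cum_mono[OF that(2)] cum1 by simp
    have "0 \<le> z n + of_nat (n * p)"
      using funpow_lift_map_ge[of s "n * q"] s by (simp add: z_def)
    then have "\<not> z n + of_nat (n * p) + 1 \<le> s + of_nat (n * p)"
      using less cum_z[of n] by fastforce
    moreover have "\<not> s + of_nat (n * p) + 1 \<le> z n + of_nat (n * p)"
      using less[of "s + of_nat (n * p)"] cum_z[of n] s by fastforce
    ultimately show ?thesis by linarith
  qed
  define D where "D = (\<lambda>j::nat. of_nat q * \<alpha> + of_nat j * (x2 - x1) - of_nat p) ` {..q}"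
  have "finite D" by (simp add: D_def)
  then obtain \<delta> where \<delta>: "0 < \<delta>" "\<And>d. d \<in> D \<Longrightarrow> d \<noteq> 0 \<Longrightarrow> \<delta> \<le> \<bar>d\<bar>"
    using finite_set_avoid[of D 0] by (auto simp: dist_real_def)
  have step: "\<delta> \<le> \<bar>z (Suc n) - z n\<bar>" for n
  proof (rule \<delta>(2))
    obtain j where "j \<le> q" "(lift_map ^^ q) (z n) = z n + of_nat q * \<alpha> + of_nat j * (x2 - x1)"
      using funpow_lift_map_displacement[OF z_SL] by blast
    then show "z (Suc n) - z n \<in> D" by (auto simp: z_Suc D_def)
    show "z (Suc n) - z n \<noteq> 0"
      using funpow_lift_map_aperiodic[OF z_SL, of q n "int p"] q by (auto simp: z_Suc)
  qed
  \<comment> \<open>Sign of the first displacement; the monotone \<open>q\<close>-th iterate passes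
    it on to all later ones.\<close>
  obtain \<sigma> :: real where \<sigma>: "\<sigma> = 1 \<or> \<sigma> = -1" "0 \<le> \<sigma> * (z 1 - z 0)"
    by (metis linear diff_ge_0_iff_ge mult_1 mult_minus1 minus_diff_eq)
  have mono: "0 \<le> \<sigma> * (z (Suc n) - z n)" for n
  proof (induction n)
    case (Suc n)
    then show ?case
      using \<sigma>(1) funpow_lift_map_mono[of "z n" "z (Suc n)" q] funpow_lift_map_mono[of "z (Suc n)" "z n" q]
      by (auto simp: z_Suc[of n] z_Suc[of "Suc n"])
  qed (use \<sigma> in simp)
  have "of_nat n * \<delta> \<le> \<sigma> * (z n - z 0)" for n
  proof (induction n)
    case (Suc n)
    have "\<delta> \<le> \<sigma> * (z (Suc n) - z n)" using \<sigma>(1) mono[of n] step[of n] by auto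
    then show ?case using Suc by (simp add: algebra_simps)
  qed simp
  moreover have "\<sigma> * (z n - z 0) \<le> 1" for n
    using z_bounded[of n] \<sigma>(1) by (auto simp: z_def abs_le_iff)
  moreover obtain n where "1 < of_nat n * \<delta>" using reals_Archimedean3[OF \<delta>(1)] by blast
  ultimately show False by (meson not_le order_trans)
qed

end

section \<open>The given parameters: steps by multiples of \<open>1 / a\<close>\<close>

theorem lemma1p8:
  fixes a c x1 x2 \<alpha> :: real and S :: "real set"
  assumes "0 < a" and "a < 1" and "1 < c" and "c \<notin> \<nat>"
    and "x1 = max ((a + frac c - 1) / a) 0"
    and "x2 = min (frac c / a) 1"
    and "\<alpha> = (if x2 \<noteq> 1 then frac (of_int \<lfloor>c\<rfloor> / a) else frac (c / a))"
    and "S = max_invariant_set \<alpha> x1 x2"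
    and "S \<noteq> {}"
  shows "squeeze_map S \<alpha> \<in> \<rat> \<longleftrightarrow> a \<in> \<rat>"
proof -
  define k where "k = nat \<lfloor>c\<rfloor>"
  have k: "1 \<le> k" "of_int \<lfloor>c\<rfloor> = real k" using assms(3) by (auto simp: k_def le_nat_iff)
  have frac_c: "frac c = c - real k" using k by (simp add: frac_def)
  have "frac c \<noteq> 0"
  proof
    assume "frac c = 0"
    then have "c = real k" using frac_c by simp
    then show False using assms(4) by simp
  qed
  then have c: "0 < frac c" "frac c < 1" using frac_ge_0[of c] frac_lt_1[of c] by linarith+
  interpret holed_rotation \<alpha> x1 x2
  proof
    have "(a + frac c - 1) / a < frac c / a" "(a + frac c - 1) / a < 1" "0 < frac c / a"
      using assms(1,2) c by (auto simp: field_simps)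
    then show "x1 < x2" unfolding assms(5,6) by auto
  qed (use assms(1,5,6,7) c frac_ge_0 frac_lt_1 in auto)
  interpret R: holed_rotation_nonempty \<alpha> x1 x2
    by unfold_locales (use assms(8,9) in simp)
  have x1_pos: "x1 = (a + frac c - 1) / a" if "0 < x1" using that assms(5) by (auto simp: max_def split: if_splits)
  have x2_lt: "x2 = frac c / a" if "x2 < 1" using that assms(6) by (auto simp: min_def split: if_splits)
  have length: "x2 - x1 = 1 / a - 1" if "0 < x1" "x2 < 1"
    using x1_pos x2_lt that assms(1) by (simp add: field_simps)
  \<comment> \<open>Modulo 1, the step is \<open>(k + 1) / a\<close> left of the hole and
    \<open>k / a\<close> right of it.\<close>
  interpret R: holed_rotation_translation \<alpha> x1 x2 "1 / a"
  proof
    fix s assume "s \<in> R.SL"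
    then consider "frac s < x1" | "x2 \<le> frac s" using R.SL_subset by (auto simp: off_hole_def)
    then show "\<exists>j::nat. \<exists>i::int. 1 \<le> j \<and> lift_map s = s + real j * (1 / a) + real_of_int i"
    proof cases
      case 1
      then have x1: "0 < x1" using frac_ge_0[of s] by linarith
      have s: "lift_map s = s + \<alpha> + (x2 - x1)" using 1 by (simp add: lift_map_def)
      show ?thesis
      proof (cases "x2 = 1")
        case True
        \<comment> \<open>Here \<open>x2 - x1 = (1 - frac c) / a\<close>, and adding
          \<open>c / a\<close> gives \<open>(k + 1) / a\<close>.\<close>
        have "\<alpha> + (x2 - x1) = real (Suc k) * (1 / a) + of_int (- \<lfloor>c / a\<rfloor>)"
          using True x1_pos[OF x1] assms(1) frac_c
          by (simp add: assms(7) frac_def[of "c / a"] field_simps)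
        then show ?thesis using s by (intro exI[of _ "Suc k"] exI[of _ "- \<lfloor>c / a\<rfloor>"]) simp
      next
        case False
        then have "\<alpha> + (x2 - x1) = real (Suc k) * (1 / a) + of_int (- 1 - \<lfloor>real k / a\<rfloor>)"
          using length x1 x2_le_1 k by (simp add: assms(7) frac_def add_divide_distrib)
        then show ?thesis
          using s by (intro exI[of _ "Suc k"] exI[of _ "- 1 - \<lfloor>real k / a\<rfloor>"]) simp
      qed
    next
      case 2
      \<comment> \<open>A point right of the hole exists only for \<open>x2 < 1\<close>, which
        selects the first formula for \<alpha>.\<close>
      then have "x2 \<noteq> 1" using frac_lt_1[of s] by linarith
      then have "\<alpha> = real k * (1 / a) + of_int (- \<lfloor>real k / a\<rfloor>)"
        using k by (simp add: assms(7) frac_def)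
      moreover have "lift_map s = s + \<alpha>" using 2 x1_less_x2 by (simp add: lift_map_def)
      ultimately show ?thesis
        using k(1) by (intro exI[of _ k] exI[of _ "- \<lfloor>real k / a\<rfloor>"]) simp
    qed
  qed
  have S: "R.S = S" by (simp add: R.S_def assms(8))
  show ?thesis
  proof
    assume "a \<in> \<rat>"
    then show "squeeze_map S \<alpha> \<in> \<rat>" using R.squeeze_map_rational S by simp
  next
    assume rat: "squeeze_map S \<alpha> \<in> \<rat>"
    show "a \<in> \<rat>"
    proof (rule ccontr)
      assume a: "a \<notin> \<rat>"
      have irr: "1 / a \<notin> \<rat>"
      proof
        assume "1 / a \<in> \<rat>"
        then have "inverse (1 / a) \<in> \<rat>" by (rule Rats_inverse)
        then show False using a by simp
      qed
      interpret R: holed_rotation_irrational \<alpha> x1 x2 "1 / a"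
        by unfold_locales (rule irr)
      have "x2 - x1 \<notin> \<rat>" if "0 < x1" "x2 < 1"
      proof
        assume "x2 - x1 \<in> \<rat>"
        then have "(x2 - x1) + 1 \<in> \<rat>" by (intro Rats_add Rats_1)
        then show False using length that irr by simp
      qed
      then show False using R.squeeze_map_irrational[OF R.measure_S_pos] rat S by simp
    qed
  qed
qed

end
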